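(* Let $f\colon\mathbb{R}^d\to\mathbb{R}$ be convex with a global minimizer $x^*$, $\|x^*\|\le\mathcal{R}$, $\mathcal{R}>0$, $f^*=f(x^* )$, and suppose that $f$ is $(\mathcal{M}_0,\mathcal{M}_1)$-Lipschitz with $\mathcal{M}_0,\mathcal{M}_1\ge0$. Let $\epsilon>0$ and let the number of iterations $K\in\mathbb{N}$ be $$K=4\cdot\Big\lceil[\mathcal{R}\mathcal{M}_1]^2+\Big[\frac{\mathcal{R}\mathcal{M}_0}{\epsilon}\Big]^2\Big\rceil .$$ Let $x_0=0$ and $x_{k+1}=\mathrm{proj}_{Q_{\mathcal{R}}}\big(x_k-\eta_k\nabla f(x_k)\big)$, where $\nabla f(x_k)\in\partial f(x_k)$ is an arbitrary subgradient and the stepsizes are chosen according to either of the following options: $$\text{Option A: }\ \eta_k=\frac{\mathcal{R}}{\|\nabla f(x_k)\|\sqrt{K+1}},\qquad\text{Option B: }\ \eta_k=\frac{f(x_k)-f^*}{\|\nabla f(x_k)\|^2}.$$ Then, for each of the two options, $$\min_{k\in\{0,\dots,K\}}[f(x_k)-f^*]\le\epsilon .$$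
   Context: $\|\cdot\|$ is the Euclidean norm; $Q_{\mathcal{R}}=\{x\in\mathbb{R}^d:\|x\|\le\mathcal{R}\}$; $\mathrm{proj}_{Q_{\mathcal R}}$ is the Euclidean projection onto $Q_{\mathcal R}$; $\mathbb{N}$ is the set of positive integers. Convention: $0/0=0$ and $1/0=+\infty$; if $\nabla f(x_k)=0$ then $x_k$ is a minimizer and the step $\eta_k\nabla f(x_k)$ is read as $0$. $f$ is $(\mathcal{M}_0,\mathcal{M}_1)$-Lipschitz if $\limsup_{u\to0}\frac{1}{\|u\|}|f(x+u)-f(x)|\le\mathcal{M}_0+\mathcal{M}_1[f(x)-f^*]$ for all $x\in\mathbb{R}^d$ (for convex $f$, equivalently: $\|g\|\le\mathcal{M}_0+\mathcal{M}_1[f(x)-f^*]$ for all $x$ and all $g\in\partial f(x)$). *)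

theory Defs
  imports "HOL-Analysis.Analysis"
begin

definition subdifferential :: "('a::real_inner \<Rightarrow> real) \<Rightarrow> 'a \<Rightarrow> 'a set" where
  "subdifferential f x = {g. \<forall>y. f y \<ge> f x + g \<bullet> (y - x)}"

(* The limsup is taken over u tending to 0 with u different from 0, in the extended reals,
   so an infinite limsup violates the bound. *)
definition gen_lipschitz ::
    "real \<Rightarrow> real \<Rightarrow> real \<Rightarrow> ('a::real_normed_vector \<Rightarrow> real) \<Rightarrow> bool" where
  "gen_lipschitz M0 M1 fstar f \<longleftrightarrow>
     (\<forall>x. Limsup (at 0) (\<lambda>u. ereal (1 / norm u * \<bar>f (x + u) - f x\<bar>))
            \<le> ereal (M0 + M1 * (f x - fstar)))"

end

theory Submission
  imports Defs
begin

text \<open>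
  Suppose that every gap \<open>\<delta>\<^sub>k = f (x\<^sub>k) - f\<^sup>*\<close> exceeds \<open>\<epsilon>\<close>. The Lipschitz
  condition bounds subgradients by \<open>M0 + M1 * \<delta>\<^sub>k\<close>, which is at most
  \<open>(\<delta>\<^sub>k / \<epsilon>) * (M0 + M1 * \<epsilon>)\<close>; so with \<open>q = \<epsilon> / (M0 + M1 * \<epsilon>)\<close> we have
  \<open>q * norm g\<^sub>k \<le> \<delta>\<^sub>k \<le> g\<^sub>k \<bullet> (x\<^sub>k - x\<^sup>*)\<close>, and the choice of \<open>K\<close> gives
  \<open>2 * R\<^sup>2 \<le> K * q\<^sup>2\<close>. Under either step size each step then lowers
  \<open>(norm (x\<^sub>k - x\<^sup>*))\<^sup>2\<close> by at least \<open>(9/5) * R\<^sup>2 / (K + 1)\<close>, and after \<open>K \<ge> 4\<close>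
  steps this exceeds the initial value, which is at most \<open>R\<^sup>2\<close>. If \<open>K = 0\<close>, then
  \<open>M0 = M1 = 0\<close>, and convexity forces \<open>f 0 = f\<^sup>*\<close>.
\<close>

text \<open>Along the ray, difference quotients of size at least \<open>c\<close> occur at
  arbitrarily small \<open>t\<close>, so the limsup at 0 cannot lie below \<open>c\<close>. Used
  with \<open>v = g\<close> for subgradients and with \<open>v = y - x\<close> for
  convexity.\<close>

lemma gen_lipschitz_ray:
  fixes f :: "'a::real_normed_vector \<Rightarrow> real"
  assumes lip: "gen_lipschitz M0 M1 fstar f" and "v \<noteq> 0"
    and ray: "\<And>t. 0 < t \<Longrightarrow> t < 1 \<Longrightarrow> t * (c * norm v) \<le> \<bar>f (x + t *\<^sub>R v) - f x\<bar>"
  shows "c \<le> M0 + M1 * (f x - fstar)"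
proof (rule ccontr)
  assume "\<not> ?thesis"
  then have "Limsup (at 0) (\<lambda>u. ereal (1 / norm u * \<bar>f (x + u) - f x\<bar>)) < ereal c"
    using lip unfolding gen_lipschitz_def
    by (meson ereal_less_eq(3) leD leI order_le_less_trans)
  then have "\<forall>\<^sub>F u in at 0. 1 / norm u * \<bar>f (x + u) - f x\<bar> < c"
    by (auto dest!: Limsup_lessD)
  then obtain d where "d > 0"
    and d: "\<And>u. u \<noteq> 0 \<Longrightarrow> norm u < d \<Longrightarrow> 1 / norm u * \<bar>f (x + u) - f x\<bar> < c"
    by (auto simp: eventually_at dist_norm)
  \<comment> \<open>The entry \<open>1/2\<close> keeps \<open>t\<close> in the range of
    \<open>ray\<close>; the other keeps \<open>t * norm v\<close> at most
    \<open>d / 2\<close>.\<close>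
  define t where "t = min (1/2) (d / (2 * norm v))"
  have t: "0 < t" "t < 1" using \<open>d > 0\<close> \<open>v \<noteq> 0\<close> by (auto simp: t_def)
  have "t * norm v \<le> d / (2 * norm v) * norm v"
    unfolding t_def by (intro mult_right_mono) auto
  also have "\<dots> < d" using \<open>d > 0\<close> \<open>v \<noteq> 0\<close> by simp
  finally have "norm (t *\<^sub>R v) < d" using t by simp
  then have "1 / norm (t *\<^sub>R v) * \<bar>f (x + t *\<^sub>R v) - f x\<bar> < c"
    using d[of "t *\<^sub>R v"] t \<open>v \<noteq> 0\<close> by simp
  then have "\<bar>f (x + t *\<^sub>R v) - f x\<bar> < t * (c * norm v)"
    using t \<open>v \<noteq> 0\<close> by (simp add: field_simps)
  with ray[OF t] show False by simp
qed

text \<open>From \<open>x\<close> in the direction \<open>g\<close> itself, the subgradient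
  inequality makes \<open>f\<close> grow at rate at least \<open>norm g\<close>.\<close>

lemma norm_subgradient_le:
  assumes "gen_lipschitz M0 M1 fstar f" "g \<in> subdifferential f x" "g \<noteq> 0"
  shows "norm g \<le> M0 + M1 * (f x - fstar)"
proof (rule gen_lipschitz_ray[OF assms(1,3)])
  fix t :: real
  assume "0 < t" "t < 1"
  have "f x + g \<bullet> (x + t *\<^sub>R g - x) \<le> f (x + t *\<^sub>R g)"
    using assms(2) unfolding subdifferential_def by blast
  then show "t * (norm g * norm g) \<le> \<bar>f (x + t *\<^sub>R g) - f x\<bar>"
    by (simp add: power2_norm_eq_inner flip: power2_eq_square)
qed

text \<open>By convexity \<open>f\<close> falls from \<open>x\<close> towards \<open>y\<close> at
  least as fast as the chord. This serves the case \<open>K = 0\<close>, where no subgradient is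
  given.\<close>

lemma gap_le_gen_lipschitz:
  fixes f :: "'a::real_normed_vector \<Rightarrow> real"
  assumes "convex_on UNIV f" and lip: "gen_lipschitz M0 M1 fstar f"
  shows "f x - f y \<le> (M0 + M1 * (f x - fstar)) * norm (y - x)"
proof (cases "y = x")
  case False
  have "(f x - f y) / norm (y - x) \<le> M0 + M1 * (f x - fstar)"
  proof (rule gen_lipschitz_ray[OF lip])
    fix t :: real
    assume t: "0 < t" "t < 1"
    have "f ((1 - t) *\<^sub>R x + t *\<^sub>R y) \<le> (1 - t) * f x + t * f y"
      using assms(1) t by (intro convex_onD) auto
    moreover have "(1 - t) *\<^sub>R x + t *\<^sub>R y = x + t *\<^sub>R (y - x)"
      by (simp add: algebra_simps)
    ultimately have "t * (f x - f y) \<le> f x - f (x + t *\<^sub>R (y - x))"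
      by (simp add: algebra_simps)
    then show "t * ((f x - f y) / norm (y - x) * norm (y - x)) \<le> \<bar>f (x + t *\<^sub>R (y - x)) - f x\<bar>"
      using False by simp
  qed (use False in simp)
  then show ?thesis using False by (simp add: pos_divide_le_eq)
qed simp

text \<open>Projection onto \<open>S\<close> is nonexpansive and fixes \<open>z\<close>.\<close>

lemma projected_step_dist:
  fixes y z g :: "'a::euclidean_space"
  assumes "convex S" "closed S" "z \<in> S"
  shows "(norm (closest_point S (y - \<eta> *\<^sub>R g) - z))\<^sup>2
         \<le> (norm (y - z))\<^sup>2 - 2 * \<eta> * (g \<bullet> (y - z)) + (\<eta> * norm g)\<^sup>2"
proof -
  have "dist (closest_point S (y - \<eta> *\<^sub>R g)) (closest_point S z) \<le> dist (y - \<eta> *\<^sub>R g) z"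
    using assms by (intro closest_point_lipschitz) auto
  then have "norm (closest_point S (y - \<eta> *\<^sub>R g) - z) \<le> norm ((y - z) - \<eta> *\<^sub>R g)"
    using assms(3) by (simp add: closest_point_self dist_norm algebra_simps)
  then have "(norm (closest_point S (y - \<eta> *\<^sub>R g) - z))\<^sup>2 \<le> (norm ((y - z) - \<eta> *\<^sub>R g))\<^sup>2"
    by (rule power_mono) simp
  also have "\<dots> = (norm (y - z))\<^sup>2 - 2 * \<eta> * (g \<bullet> (y - z)) + (\<eta> * norm g)\<^sup>2"
    unfolding power_mult_distrib power2_norm_eq_inner
    by (simp add: inner_diff inner_commute algebra_simps power2_eq_square)
  finally show ?thesis .
qed

text \<open>With \<open>n = norm g\<close> and \<open>ip = g \<bullet> (y - z)\<close>, the left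
  side is the change of squared distance allowed by \<open>projected_step_dist\<close>.\<close>

lemma step_gain:
  fixes R q n \<delta> ip :: real
  assumes "R > 0" "q > 0" "n > 0" "q * n \<le> \<delta>" "\<delta> \<le> ip"
    and Kq: "2 * R\<^sup>2 \<le> real K * q\<^sup>2"
    and \<eta>: "\<eta> = R / (n * sqrt (real (K + 1))) \<or> \<eta> = \<delta> / n\<^sup>2"
  shows "(\<eta> * n)\<^sup>2 - 2 * \<eta> * ip \<le> - (9/5 * R\<^sup>2 / real (K + 1))"
proof -
  define w where "w = 1 / sqrt (real (K + 1))"
  have w: "w > 0" "w\<^sup>2 = 1 / real (K + 1)" by (simp_all add: w_def power_divide)
  have "2 * R\<^sup>2 \<le> real (K + 1) * q\<^sup>2" using Kq by (simp add: distrib_right add_increasing)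
  then have qw: "2 * (R * w)\<^sup>2 \<le> q\<^sup>2"
    by (simp add: power_mult_distrib w(2) field_simps)
  have goal: "9/5 * R\<^sup>2 / real (K + 1) = 9/5 * (R * w)\<^sup>2"
    by (simp add: power_mult_distrib w(2))
  have "\<delta> > 0" using assms(2-4) by (smt (verit) mult_pos_pos)
  from \<eta> show ?thesis
  proof
    assume "\<eta> = R / (n * sqrt (real (K + 1)))"
    then have \<eta>n: "\<eta> * n = R * w" and \<eta>w: "\<eta> = R * w / n" using \<open>n > 0\<close> by (simp_all add: w_def)
    \<comment> \<open>\<open>7/5\<close> is a rational lower bound for the square root of 2; the
      gain is then \<open>2 * (7/5) - 1 = 9/5\<close> times \<open>(R * w)\<^sup>2\<close>.\<close>
    have "(7/5 * a)\<^sup>2 \<le> 2 * a\<^sup>2" for a :: real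
      unfolding power_mult_distrib by (intro mult_right_mono) (auto simp: power2_eq_square)
    then have "(7/5 * (R * w))\<^sup>2 \<le> q\<^sup>2" using qw by (rule order_trans)
    then have "7/5 * (R * w) \<le> q" using \<open>q > 0\<close> by (rule power2_le_imp_le[OF _ less_imp_le])
    then have "(R * w) * (7/5 * (R * w)) \<le> (R * w) * q"
      using \<open>R > 0\<close> w by (intro mult_left_mono) auto
    also have "\<dots> = \<eta> * (q * n)" using \<eta>n by (simp add: ac_simps)
    also have "\<dots> \<le> \<eta> * ip"
      using assms \<eta>w w by (intro mult_left_mono) auto
    finally show ?thesis unfolding goal \<eta>n by (simp add: power2_eq_square)
  next
    \<comment> \<open>This step minimizes
      \<open>(\<eta> * n)\<^sup>2 - 2 * \<eta> * \<delta>\<close>, with value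
      \<open>- (\<delta> / n)\<^sup>2\<close>, so the gain is even
      \<open>2 * (R * w)\<^sup>2\<close>.\<close>
    assume \<eta>: "\<eta> = \<delta> / n\<^sup>2"
    have "q \<le> \<delta> / n" using assms by (simp add: pos_le_divide_eq)
    then have "q\<^sup>2 \<le> (\<delta> / n)\<^sup>2" using \<open>q > 0\<close> by (intro power_mono) auto
    moreover have "(\<eta> * n)\<^sup>2 = (\<delta> / n)\<^sup>2" using \<eta> \<open>n > 0\<close> by (simp add: power2_eq_square)
    moreover have "(\<delta> / n)\<^sup>2 = \<eta> * \<delta>" using \<eta> by (simp add: power2_eq_square)
    moreover have "\<eta> * \<delta> \<le> \<eta> * ip" using \<open>\<delta> \<le> ip\<close> \<open>\<delta> > 0\<close> \<eta> by (intro mult_left_mono) auto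
    ultimately show ?thesis unfolding goal using qw zero_le_power2[of "R * w"] by linarith
  qed
qed

theorem theorem2:
  fixes f :: "real ^ 'd \<Rightarrow> real"
    and xstar :: "real ^ 'd"
    and fstar R M0 M1 \<epsilon> :: real
    and K :: nat
    and x g :: "nat \<Rightarrow> real ^ 'd"
    and \<eta> :: "nat \<Rightarrow> real"
  assumes "convex_on UNIV f"
    and "\<And>y. f xstar \<le> f y"
    and "norm xstar \<le> R"
    and "R > 0"
    and "fstar = f xstar"
    and "M0 \<ge> 0" and "M1 \<ge> 0"
    and "gen_lipschitz M0 M1 fstar f"
    and "\<epsilon> > 0"
    and "int K = 4 * \<lceil>(R * M1)\<^sup>2 + (R * M0 / \<epsilon>)\<^sup>2\<rceil>"
    and "x 0 = 0"
    and "\<And>k. k < K \<Longrightarrow> g k \<in> subdifferential f (x k)"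
    and "\<And>k. k < K \<Longrightarrow> x (Suc k) = closest_point (cball 0 R) (x k - \<eta> k *\<^sub>R g k)"
    and "(\<forall>k<K. \<eta> k = R / (norm (g k) * sqrt (real (K + 1)))) \<or>
         (\<forall>k<K. \<eta> k = (f (x k) - fstar) / (norm (g k))\<^sup>2)"
  shows "Min ((\<lambda>k. f (x k) - fstar) ` {0..K}) \<le> \<epsilon>"
proof (rule ccontr)
  assume "\<not> ?thesis"
  then have gap: "\<epsilon> < f (x k) - fstar" if "k \<le> K" for k
    using that by (subst (asm) not_le, subst (asm) Min_gr_iff) auto
  let ?c = "(R * M1)\<^sup>2 + (R * M0 / \<epsilon>)\<^sup>2"
  have "?c \<ge> 0" by simp
  have Kc: "4 * ?c \<le> real K"
  proof -
    have "real K = 4 * real_of_int \<lceil>?c\<rceil>" using assms(10) by linarith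
    then show ?thesis using le_of_int_ceiling[of ?c] by (simp only: mult_le_cancel_left_pos zero_less_numeral)
  qed
  define L where "L = M0 + M1 * \<epsilon>"
  show False
  proof (cases "K = 0")
    case True
    then have "?c \<le> 0" using Kc by simp
    then have "R * M1 = 0" "R * M0 / \<epsilon> = 0" unfolding sum_power2_le_zero_iff by blast+
    then have "M0 = 0" "M1 = 0" using \<open>R > 0\<close> \<open>\<epsilon> > 0\<close> by auto
    then have "f (x 0) - f xstar \<le> 0"
      using gap_le_gen_lipschitz[OF assms(1,8), of "x 0" xstar] by simp
    then show False using gap[of 0] \<open>\<epsilon> > 0\<close> \<open>fstar = f xstar\<close> by simp
  next
    case False
    \<comment> \<open>\<open>K\<close> is a nonzero multiple of 4.\<close>
    then have "K \<ge> 4" using assms(10) by presburger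
    have ip: "f (x k) - fstar \<le> g k \<bullet> (x k - xstar)" if "k < K" for k
    proof -
      have "f (x k) + g k \<bullet> (xstar - x k) \<le> f xstar"
        using assms(12)[OF that] unfolding subdifferential_def by blast
      then show ?thesis using assms(5) by (simp add: inner_diff_right)
    qed
    \<comment> \<open>A zero subgradient would make the gap nonpositive; hence no step size divides
      by zero.\<close>
    have g_nz: "g k \<noteq> 0" if "k < K" for k
      using ip[OF that] gap[of k] that \<open>\<epsilon> > 0\<close> by auto
    have g_le: "\<epsilon> * norm (g k) \<le> L * (f (x k) - fstar)" if "k < K" for k
    proof -
      let ?d = "f (x k) - fstar"
      have "\<epsilon> * norm (g k) \<le> \<epsilon> * (M0 + M1 * ?d)"
        using norm_subgradient_le[OF assms(8) assms(12)[OF that] g_nz[OF that]] \<open>\<epsilon> > 0\<close>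
        by (intro mult_left_mono) auto
      also have "\<dots> \<le> L * ?d"
        using mult_right_mono[OF less_imp_le[OF gap[of k]] \<open>M0 \<ge> 0\<close>] that
        by (simp add: L_def algebra_simps)
      finally show ?thesis .
    qed
    \<comment> \<open>\<open>L = 0\<close> would force \<open>g 0 = 0\<close>.\<close>
    have "L > 0"
    proof -
      have "0 < \<epsilon> * norm (g 0)" using g_nz[of 0] \<open>\<epsilon> > 0\<close> False by simp
      also have "\<dots> \<le> L * (f (x 0) - fstar)" using g_le[of 0] False by simp
      finally show ?thesis using gap[of 0] \<open>\<epsilon> > 0\<close> by (simp add: zero_less_mult_iff)
    qed
    define q where "q = \<epsilon> / L"
    have "q > 0" using \<open>L > 0\<close> \<open>\<epsilon> > 0\<close> by (simp add: q_def)
    have qg: "q * norm (g k) \<le> f (x k) - fstar" if "k < K" for k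
      using g_le[OF that] \<open>L > 0\<close> by (simp add: q_def field_simps)
    have Kq: "2 * R\<^sup>2 \<le> real K * q\<^sup>2"
    proof -
      \<comment> \<open>Of the factor 4 in \<open>K\<close>, a factor 2 pays for
        \<open>(a + b)\<^sup>2 \<le> 2 * (a\<^sup>2 + b\<^sup>2)\<close>; the other 2 remains for
        \<open>step_gain\<close>.\<close>
      have "R * M1 + R * M0 / \<epsilon> = R / q"
        using \<open>\<epsilon> > 0\<close> \<open>L > 0\<close> by (simp add: q_def L_def field_simps)
      moreover have "(a + b)\<^sup>2 \<le> 2 * (a\<^sup>2 + b\<^sup>2)" for a b :: real
        using sum_squares_bound[of a b] by (simp add: power2_sum)
      ultimately have "(R / q)\<^sup>2 \<le> 2 * ?c" by metis
      then have "2 * (R / q)\<^sup>2 \<le> real K" using Kc by linarith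
      then show ?thesis using \<open>q > 0\<close> by (simp add: power_divide pos_divide_le_eq)
    qed
    let ?D = "9/5 * R\<^sup>2 / real (K + 1)"
    have step: "(norm (x (Suc k) - xstar))\<^sup>2 \<le> (norm (x k - xstar))\<^sup>2 - ?D" if "k < K" for k
    proof -
      have "(\<eta> k * norm (g k))\<^sup>2 - 2 * \<eta> k * (g k \<bullet> (x k - xstar)) \<le> - ?D"
        using assms(14) that
        by (intro step_gain[OF \<open>R > 0\<close> \<open>q > 0\<close> _ qg[OF that] ip[OF that] Kq])
           (auto simp: g_nz)
      moreover have "(norm (x (Suc k) - xstar))\<^sup>2 \<le> (norm (x k - xstar))\<^sup>2
          - 2 * \<eta> k * (g k \<bullet> (x k - xstar)) + (\<eta> k * norm (g k))\<^sup>2"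
        unfolding assms(13)[OF that] using assms(3) by (intro projected_step_dist) auto
      ultimately show ?thesis by linarith
    qed
    have total: "(norm (x k - xstar))\<^sup>2 \<le> R\<^sup>2 - real k * ?D" if "k \<le> K" for k
      using that
    proof (induction k)
      case 0
      show ?case using assms(3,11) by (simp add: power_mono)
    next
      case (Suc k)
      have "real (Suc k) * ?D = real k * ?D + ?D" by (simp only: of_nat_Suc distrib_right mult_1)
      then show ?case using step[of k] Suc by linarith
    qed
    \<comment> \<open>The inequality amounts to \<open>5 * (K + 1) < 9 * K\<close>.\<close>
    have "R\<^sup>2 < real K * ?D"
      using \<open>K \<ge> 4\<close> \<open>R > 0\<close> by (simp add: field_simps)
    then show False using total[of K] zero_le_power2[of "norm (x K - xstar)"] by linarith
  qed
qed

end
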